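(* Let $n\ge1$, let $\Sigma_1,\ldots,\Sigma_n,O$ be finite nonempty sets, let $f\colon\Sigma_1\times\cdots\times\Sigma_n\to O$ and let $H\ge1$ be an integer. Then $\mathrm{rk}(f)\le H\cdot\mathrm{rk}^{(H)}(f)$.
   Context: An assignment is a pair $(i,\sigma)$ with $i\in\{1,\ldots,n\}$, $\sigma\in\Sigma_i$; $A$ is the set of all assignments. The assignment $(i,\sigma)$ is consistent with $\bar w=(\sigma_1,\ldots,\sigma_n)$ iff $\sigma_i=\sigma$. For a bijection $\tau\colon\{1,\ldots,|A|\}\to A$ (a permutation of $A$), the a-query $q_\tau\colon\Sigma_1\times\cdots\times\Sigma_n\to A$ is defined by $q_\tau(\bar w)=\tau(j)$ for the minimal $j$ such that $\tau(j)$ is consistent with $\bar w$. An $H$-degree a-query is a product $\bar w\mapsto(q_{\tau_1}(\bar w),\ldots,q_{\tau_H}(\bar w))$ of $H$ a-queries. A decision tree over a family of queries is a rooted tree in which each non-leaf node $v$ is labeled by a query $q_v$ from the family and has exactly $|\mathrm{Im}(q_v)|$ outgoing edges, labeled by the distinct elements of $\mathrm{Im}(q_v)$, and each leaf is labeled by an element of $O$; on input $\bar w$ one descends from the root, at each $v$ following the edge labeled $q_v(\bar w)$, and outputs the label of the leaf reached. The tree computes $f$ if it outputs $f(\bar w)$ on every input $\bar w$. The depth is the maximal number of edges on a root-to-leaf path. $\mathrm{rk}(f)$ is the minimal depth of a decision tree over a-queries computing $f$, and $\mathrm{rk}^{(H)}(f)$ is the minimal depth of a decision tree over $H$-degree a-queries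 computing $f$. *)

theory Defs
  imports Main "HOL-Library.FuncSet"
begin

definition inputs :: "nat \<Rightarrow> (nat \<Rightarrow> 'a set) \<Rightarrow> (nat \<Rightarrow> 'a) set" where
  "inputs n S = (\<Pi>\<^sub>E i\<in>{1..n}. S i)"

definition assignments :: "nat \<Rightarrow> (nat \<Rightarrow> 'a set) \<Rightarrow> (nat \<times> 'a) set" where
  "assignments n S = (SIGMA i:{1..n}. S i)"

definition consistent :: "nat \<times> 'a \<Rightarrow> (nat \<Rightarrow> 'a) \<Rightarrow> bool" where
  "consistent a w \<longleftrightarrow> w (fst a) = snd a"

definition assignment_perms :: "nat \<Rightarrow> (nat \<Rightarrow> 'a set) \<Rightarrow> (nat \<Rightarrow> nat \<times> 'a) set" where
  "assignment_perms n S =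
     {\<tau>. bij_betw \<tau> {1..card (assignments n S)} (assignments n S)}"

(* The LEAST exists whenever n \<ge> 1, \<tau> is in assignment_perms n S and w is in inputs n S. *)
definition a_query ::
    "nat \<Rightarrow> (nat \<Rightarrow> 'a set) \<Rightarrow> (nat \<Rightarrow> nat \<times> 'a) \<Rightarrow> (nat \<Rightarrow> 'a) \<Rightarrow> nat \<times> 'a" where
  "a_query n S \<tau> w =
     \<tau> (LEAST j. j \<in> {1..card (assignments n S)} \<and> consistent (\<tau> j) w)"

definition a_queries ::
    "nat \<Rightarrow> (nat \<Rightarrow> 'a set) \<Rightarrow> ((nat \<Rightarrow> 'a) \<Rightarrow> nat \<times> 'a) set" where
  "a_queries n S = {a_query n S \<tau> | \<tau>. \<tau> \<in> assignment_perms n S}"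

(* H-tuples are represented by lists of length H. *)
definition degree_a_queries ::
    "nat \<Rightarrow> nat \<Rightarrow> (nat \<Rightarrow> 'a set) \<Rightarrow> ((nat \<Rightarrow> 'a) \<Rightarrow> (nat \<times> 'a) list) set" where
  "degree_a_queries H n S =
     {\<lambda>w. map (\<lambda>\<tau>. a_query n S \<tau> w) \<tau>s | \<tau>s.
        length \<tau>s = H \<and> set \<tau>s \<subseteq> assignment_perms n S}"

(* The partial map of a node sends each label of an outgoing edge to the subtree below it. *)
datatype ('w, 'r, 'o) tree =
    Leaf 'o
  | Node "'w \<Rightarrow> 'r" "'r \<Rightarrow> ('w, 'r, 'o) tree option"

inductive decision_tree ::
    "'w set \<Rightarrow> ('w \<Rightarrow> 'r) set \<Rightarrow> 'o set \<Rightarrow> ('w, 'r, 'o) tree \<Rightarrow> bool"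
  for W :: "'w set" and Q :: "('w \<Rightarrow> 'r) set" and Y :: "'o set" where
  Leaf: "y \<in> Y \<Longrightarrow> decision_tree W Q Y (Leaf y)"
| Node: "\<lbrakk>q \<in> Q; dom c = q ` W; \<And>r t. c r = Some t \<Longrightarrow> decision_tree W Q Y t\<rbrakk>
    \<Longrightarrow> decision_tree W Q Y (Node q c)"

primrec tree_output :: "('w, 'r, 'o) tree \<Rightarrow> 'w \<Rightarrow> 'o" where
  "tree_output (Leaf y) = (\<lambda>w. y)"
| "tree_output (Node q c) = (\<lambda>w. the ((map_option tree_output \<circ> c) (q w)) w)"

(* Max is taken over a finite nonempty set when W is finite and nonempty and dom c = q ` W. *)
primrec depth :: "('w, 'r, 'o) tree \<Rightarrow> nat" where
  "depth (Leaf y) = 0"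
| "depth (Node q c) = Suc (Max (ran (map_option depth \<circ> c)))"

definition computes :: "'w set \<Rightarrow> ('w, 'r, 'o) tree \<Rightarrow> ('w \<Rightarrow> 'o) \<Rightarrow> bool" where
  "computes W t f \<longleftrightarrow> (\<forall>w\<in>W. tree_output t w = f w)"

definition min_depth :: "'w set \<Rightarrow> ('w \<Rightarrow> 'r) set \<Rightarrow> 'o set \<Rightarrow> ('w \<Rightarrow> 'o) \<Rightarrow> nat" where
  "min_depth W Q Y f =
     (LEAST d. \<exists>t. decision_tree W Q Y t \<and> computes W t f \<and> depth t = d)"

definition rk :: "nat \<Rightarrow> (nat \<Rightarrow> 'a set) \<Rightarrow> 'o set \<Rightarrow> ((nat \<Rightarrow> 'a) \<Rightarrow> 'o) \<Rightarrow> nat" where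
  "rk n S Y f = min_depth (inputs n S) (a_queries n S) Y f"

definition rk_degree ::
    "nat \<Rightarrow> nat \<Rightarrow> (nat \<Rightarrow> 'a set) \<Rightarrow> 'o set \<Rightarrow> ((nat \<Rightarrow> 'a) \<Rightarrow> 'o) \<Rightarrow> nat" where
  "rk_degree H n S Y f = min_depth (inputs n S) (degree_a_queries H n S) Y f"

end

(* A node labelled by (q_1, ..., q_H) is simulated by asking q_1, ..., q_H one after another: the
   answers determine the outgoing edge, and combinations of answers that are not in the image of
   the product query are closed off by an arbitrary leaf. Since the rank is defined as a least
   depth, one also needs that f is computed by some tree over H-degree a-queries; this holds
   because a-queries separate inputs. *)
theory Submission
  imports Defs "HOL-Combinatorics.Transposition"
begin

section \<open>Decision trees over arbitrary query families\<close>

lemma depth_Node_le: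
  assumes "finite W" "W \<noteq> {}" "dom c = q ` W"
    and "\<And>r t. c r = Some t \<Longrightarrow> depth t \<le> d"
  shows "depth (Node q c) \<le> Suc d"
proof -
  have "finite (ran (map_option depth \<circ> c))"
    using assms(1,3) by (intro finite_ran) (simp add: dom_map_option_comp)
  \<comment> \<open>\<open>Max\<close> is informative only on a nonempty set; a nonempty
    \<open>W\<close> gives the node at least one child.\<close>
  moreover have "ran (map_option depth \<circ> c) \<noteq> {}"
    using assms(2,3) by (auto simp: ran_def dom_def)
  ultimately show ?thesis
    using assms(4) by (auto simp: ran_def)
qed

lemma depth_child_less:
  assumes "finite W" "dom c = q ` W" "c r = Some t"
  shows "depth t < depth (Node q c)"
proof -
  have "finite (ran (map_option depth \<circ> c))"
    using assms(1,2) by (intro finite_ran) (simp add: dom_map_option_comp)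
  moreover have "depth t \<in> ran (map_option depth \<circ> c)"
    using assms(3) by (auto simp: ran_def)
  ultimately show ?thesis
    by (simp add: less_Suc_eq_le)
qed

text \<open>The queries are asked in order, and \<open>g\<close> is a continuation: it selects the
  tree to run once all answers are known.\<close>

lemma query_list_tree:
  assumes W: "finite W" "W \<noteq> {}" and "set qs \<subseteq> Q"
    and "\<And>rs. decision_tree W Q Y (g rs)" "\<And>rs. depth (g rs) \<le> d"
  shows "\<exists>t. decision_tree W Q Y t \<and> depth t \<le> length qs + d
    \<and> (\<forall>w\<in>W. tree_output t w = tree_output (g (map (\<lambda>q. q w) qs)) w)"
  using assms(3-)
proof (induction qs arbitrary: g)
  case Nil
  then show ?case by auto
next
  case (Cons q qs)
  \<comment> \<open>The induction hypothesis is used with the continuation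
    \<open>\<lambda>rs. g (r # rs)\<close>, which remembers the first answer
    \<open>r\<close>.\<close>
  have "\<exists>t. decision_tree W Q Y t \<and> depth t \<le> length qs + d
    \<and> (\<forall>w\<in>W. tree_output t w = tree_output (g (r # map (\<lambda>q. q w) qs)) w)" for r
    using Cons.prems by (intro Cons.IH) auto
  then obtain T where T: "\<And>r. decision_tree W Q Y (T r)" "\<And>r. depth (T r) \<le> length qs + d"
    "\<And>r w. w \<in> W \<Longrightarrow> tree_output (T r) w = tree_output (g (r # map (\<lambda>q. q w) qs)) w"
    by metis
  define c where "c = (\<lambda>r. if r \<in> q ` W then Some (T r) else None)"
  have dom: "dom c = q ` W"
    by (auto simp: c_def dom_def)
  have c: "t = T r" if "c r = Some t" for r t
    using that by (simp add: c_def split: if_splits)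
  have "decision_tree W Q Y (Node q c)"
    using Cons.prems(1) T(1) c by (intro decision_tree.Node dom) auto
  moreover have "depth (Node q c) \<le> Suc (length qs + d)"
    using T(2) c by (intro depth_Node_le[OF W dom]) auto
  moreover have "\<forall>w\<in>W. tree_output (Node q c) w = tree_output (g (map (\<lambda>q. q w) (q # qs))) w"
    using T(3) by (simp add: c_def)
  ultimately show ?case
    by (intro exI[of _ "Node q c"]) auto
qed

text \<open>By induction on the tree, each level is replaced by \<open>H\<close> levels. Only the
  product form of the queries matters, so \<open>Q\<close> may be any family.\<close>

lemma simulate_product_queries:
  assumes W: "finite W" "W \<noteq> {}" and "Y \<noteq> {}"
    and Q': "Q' \<subseteq> {\<lambda>w. map (\<lambda>q. q w) qs | qs. length qs = H \<and> set qs \<subseteq> Q}"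
    and "decision_tree W Q' Y t"
  shows "\<exists>t'. decision_tree W Q Y t' \<and> depth t' \<le> H * depth t
    \<and> (\<forall>w\<in>W. tree_output t' w = tree_output t w)"
  using assms(5)
proof induction
  case (Leaf y)
  then show ?case
    by (intro exI[of _ "Leaf y"]) (auto intro: decision_tree.Leaf)
next
  case (Node p c)
  obtain qs where qs: "p = (\<lambda>w. map (\<lambda>q. q w) qs)" "length qs = H" "set qs \<subseteq> Q"
    using Node.hyps(1) Q' by blast
  obtain y where y: "y \<in> Y"
    using \<open>Y \<noteq> {}\<close> by blast
  \<comment> \<open>Children have depth at most \<open>D\<close>, so their simulations cost at most
    \<open>H * D\<close>; the \<open>H\<close> queries at the root bring this to
    \<open>H * Suc D\<close>.\<close>
  obtain D where D: "depth (Node p c) = Suc D"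
    by simp
  have "\<exists>t'. decision_tree W Q Y t' \<and> depth t' \<le> H * D
    \<and> (\<forall>t. c r = Some t \<longrightarrow> (\<forall>w\<in>W. tree_output t' w = tree_output t w))" for r
  proof (cases "c r")
    case None
    then show ?thesis
      by (intro exI[of _ "Leaf y"]) (auto intro: decision_tree.Leaf y)
  next
    case (Some t)
    obtain t' where t': "decision_tree W Q Y t'" "depth t' \<le> H * depth t"
      "\<forall>w\<in>W. tree_output t' w = tree_output t w"
      using Node.IH[OF Some] by blast
    have "depth t \<le> D"
      using depth_child_less[OF W(1) Node.hyps(2) Some] D by simp
    then have "depth t' \<le> H * D"
      using t'(2) by (meson le_trans mult_le_mono2)
    with t' Some show ?thesis by auto
  qed
  then obtain g where g: "\<And>r. decision_tree W Q Y (g r)" "\<And>r. depth (g r) \<le> H * D"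
    "\<And>r t w. c r = Some t \<Longrightarrow> w \<in> W \<Longrightarrow> tree_output (g r) w = tree_output t w"
    by metis
  obtain t' where t': "decision_tree W Q Y t'" "depth t' \<le> H + H * D"
    "\<forall>w\<in>W. tree_output t' w = tree_output (g (p w)) w"
    using query_list_tree[OF W qs(3), of Y g "H * D"] g(1,2) qs(1,2) by auto
  have "tree_output t' w = tree_output (Node p c) w" if w: "w \<in> W" for w
  proof -
    obtain t where "c (p w) = Some t"
      using Node.hyps(2) w by blast
    then show ?thesis
      using t'(3) g(3) w by simp
  qed
  then show ?case
    using t'(1,2) D by (intro exI[of _ t']) (simp del: depth.simps)
qed

text \<open>While \<open>f\<close> is not constant on \<open>V\<close>, a query telling two elements
  of \<open>V\<close> apart splits \<open>V\<close> into strictly smaller fibres. Correctness is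
  asked only on \<open>V\<close>, which shrinks, while the edges of the tree are always governed by
  the fixed set \<open>W\<close>.\<close>

lemma separating_queries_compute:
  assumes "finite V" "V \<subseteq> W" "f \<in> W \<rightarrow> Y" "Y \<noteq> {}"
    and sep: "\<And>w w'. w \<in> W \<Longrightarrow> w' \<in> W \<Longrightarrow> w \<noteq> w' \<Longrightarrow> \<exists>q\<in>Q. q w \<noteq> q w'"
  shows "\<exists>t. decision_tree W Q Y t \<and> computes V t f"
  using assms(1,2)
proof (induction V rule: finite_psubset_induct)
  case (psubset V)
  show ?case
  proof (cases "\<exists>y\<in>Y. \<forall>w\<in>V. f w = y")
    case True
    then obtain y where "y \<in> Y" "\<forall>w\<in>V. f w = y" by blast
    then show ?thesis
      by (intro exI[of _ "Leaf y"]) (auto simp: computes_def intro: decision_tree.Leaf)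
  next
    case False
    \<comment> \<open>An empty \<open>V\<close> would fall under the constant case, with any element
      of \<open>Y\<close> as value.\<close>
    then obtain w where w: "w \<in> V"
      using \<open>Y \<noteq> {}\<close> by blast
    then have "f w \<in> Y"
      using psubset.prems assms(3) by blast
    with False obtain w' where w': "w' \<in> V" "f w' \<noteq> f w" by blast
    obtain q where q: "q \<in> Q" "q w \<noteq> q w'"
      using sep[of w w'] w w' psubset.prems by blast
    have "\<exists>t. decision_tree W Q Y t \<and> computes {v \<in> V. q v = r} t f" for r
    proof (rule psubset.IH)
      have "{v \<in> V. q v = r} \<noteq> V"
        using w w'(1) q(2) by (metis (mono_tags, lifting) mem_Collect_eq)
      then show "{v \<in> V. q v = r} \<subset> V" by blast
      show "{v \<in> V. q v = r} \<subseteq> W"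
        using psubset.prems by blast
    qed
    then obtain T where T: "\<And>r. decision_tree W Q Y (T r)"
      "\<And>r. computes {v \<in> V. q v = r} (T r) f"
      by metis
    \<comment> \<open>Edges are needed for all answers on \<open>W\<close>, also for those not
      occurring on \<open>V\<close>, whose fibre is empty.\<close>
    define c where "c = (\<lambda>r. if r \<in> q ` W then Some (T r) else None)"
    have "decision_tree W Q Y (Node q c)"
      using q(1) T(1) by (intro decision_tree.Node) (auto simp: c_def dom_def split: if_splits)
    moreover have "computes V (Node q c) f"
      using T(2) psubset.prems by (auto simp: computes_def c_def)
    ultimately show ?thesis by blast
  qed
qed

text \<open>The \<open>LEAST\<close> in \<open>min_depth\<close> is known to be a depth of a
  suitable tree only once one such tree is exhibited.\<close>

lemma min_depth_attained:
  assumes "decision_tree W Q Y t" "computes W t f"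
  obtains t' where "decision_tree W Q Y t'" "computes W t' f" "depth t' = min_depth W Q Y f"
proof -
  have "\<exists>t'. decision_tree W Q Y t' \<and> computes W t' f \<and> depth t' = min_depth W Q Y f"
    unfolding min_depth_def by (rule LeastI[of _ "depth t"]) (use assms in blast)
  then show ?thesis
    using that by blast
qed

lemma min_depth_le:
  assumes "decision_tree W Q Y t" "computes W t f"
  shows "min_depth W Q Y f \<le> depth t"
  unfolding min_depth_def by (rule Least_le) (use assms in blast)

section \<open>Answers of a-queries and separation of inputs\<close>

lemma consistent_a_query:
  assumes "n \<ge> 1" "\<tau> \<in> assignment_perms n S" "w \<in> inputs n S"
  shows "consistent (a_query n S \<tau> w) w"
proof -
  \<comment> \<open>As \<open>n \<ge> 1\<close>, coordinate 1 supplies an assignment consistent with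
    \<open>w\<close>. It occurs in the enumeration \<open>\<tau>\<close>, so a minimal index
    exists.\<close>
  have "(1, w 1) \<in> assignments n S"
    using assms(1,3) by (auto simp: assignments_def inputs_def)
  also have "assignments n S = \<tau> ` {1..card (assignments n S)}"
    using assms(2) by (simp add: assignment_perms_def bij_betw_def)
  finally obtain j where "j \<in> {1..card (assignments n S)}" "\<tau> j = (1, w 1)"
    by (metis imageE)
  then have "\<exists>j. j \<in> {1..card (assignments n S)} \<and> consistent (\<tau> j) w"
    by (auto simp: consistent_def)
  from LeastI_ex[OF this] show ?thesis
    by (simp add: a_query_def)
qed

lemma a_query_eq_first:
  assumes "card (assignments n S) \<ge> 1" "consistent (\<tau> 1) w"
  shows "a_query n S \<tau> w = \<tau> 1"
proof -
  have "(LEAST j. j \<in> {1..card (assignments n S)} \<and> consistent (\<tau> j) w) = 1"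
    using assms by (intro Least_equality) auto
  then show ?thesis
    by (simp add: a_query_def)
qed

text \<open>In any enumeration, swapping position 1 with the position of \<open>a\<close> moves
  \<open>a\<close> to the front.\<close>

lemma assignment_perm_with_first:
  assumes "finite (assignments n S)" "a \<in> assignments n S"
  obtains \<tau> where "\<tau> \<in> assignment_perms n S" "\<tau> 1 = a"
proof -
  let ?I = "{1..card (assignments n S)}"
  obtain h where h: "bij_betw h ?I (assignments n S)"
    using ex_bij_betw_nat_finite_1[OF assms(1)] by blast
  then obtain j where j: "j \<in> ?I" "h j = a"
    using assms(2) by (metis bij_betw_def imageE)
  have "bij_betw (transpose 1 j) ?I ?I"
    using j(1) by (subst bij_betw_transpose_iff) auto
  then have "bij_betw (h \<circ> transpose 1 j) ?I (assignments n S)"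
    using h by (rule bij_betw_trans)
  with j show ?thesis
    by (intro that[of "h \<circ> transpose 1 j"]) (auto simp: assignment_perms_def)
qed

text \<open>Let \<open>w\<close> and \<open>w'\<close> differ at \<open>i\<close> and let
  \<open>\<tau>\<close> begin with \<open>(i, w i)\<close>. Then \<open>w\<close> receives this
  answer, whereas the answer to \<open>w'\<close> is consistent with \<open>w'\<close>, which
  \<open>(i, w i)\<close> is not.\<close>

lemma a_queries_separate:
  assumes "n \<ge> 1" "finite (assignments n S)"
    and w: "w \<in> inputs n S" "w' \<in> inputs n S" "w \<noteq> w'"
  obtains \<tau> where "\<tau> \<in> assignment_perms n S" "a_query n S \<tau> w \<noteq> a_query n S \<tau> w'"
proof -
  obtain i where i: "i \<in> {1..n}" "w i \<noteq> w' i"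
    using w unfolding inputs_def by (meson PiE_ext)
  then have a: "(i, w i) \<in> assignments n S"
    using w(1) by (auto simp: assignments_def inputs_def)
  obtain \<tau> where \<tau>: "\<tau> \<in> assignment_perms n S" "\<tau> 1 = (i, w i)"
    using assignment_perm_with_first[OF assms(2) a] .
  have "card (assignments n S) \<ge> 1"
    using a assms(2) by (auto simp: Suc_le_eq card_gt_0_iff)
  then have "a_query n S \<tau> w = (i, w i)"
    using a_query_eq_first[of n S \<tau> w] \<tau>(2) by (simp add: consistent_def)
  moreover have "consistent (a_query n S \<tau> w') w'"
    using consistent_a_query[OF assms(1) \<tau>(1) w(2)] .
  ultimately have "a_query n S \<tau> w \<noteq> a_query n S \<tau> w'"
    using i(2) by (metis consistent_def fst_conv snd_conv)
  with \<tau>(1) show ?thesis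
    using that by blast
qed

lemma degree_a_queries_separate:
  assumes "n \<ge> 1" "finite (assignments n S)" "H \<ge> 1"
    and w: "w \<in> inputs n S" "w' \<in> inputs n S" "w \<noteq> w'"
  shows "\<exists>q\<in>degree_a_queries H n S. q w \<noteq> q w'"
proof -
  obtain \<tau> where \<tau>: "\<tau> \<in> assignment_perms n S" "a_query n S \<tau> w \<noteq> a_query n S \<tau> w'"
    using a_queries_separate[OF assms(1,2) w] .
  \<comment> \<open>Repeating one separating a-query \<open>H\<close> times suffices;
    \<open>H \<ge> 1\<close> makes the answer list nonempty, so the difference shows.\<close>
  let ?q = "\<lambda>w. map (\<lambda>\<tau>. a_query n S \<tau> w) (replicate H \<tau>)"
  have "?q \<in> degree_a_queries H n S"
    unfolding degree_a_queries_def using \<tau>(1)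
    by (intro CollectI exI[of _ "replicate H \<tau>"]) auto
  moreover have "?q w \<noteq> ?q w'"
    using \<tau>(2) \<open>H \<ge> 1\<close> by auto
  ultimately show ?thesis by (intro bexI[of _ ?q])
qed

text \<open>Passing from lists of permutations to lists of a-queries gives the form that
  \<open>simulate_product_queries\<close> expects.\<close>

lemma degree_a_queries_subset:
  "degree_a_queries H n S
    \<subseteq> {\<lambda>w. map (\<lambda>q. q w) qs | qs. length qs = H \<and> set qs \<subseteq> a_queries n S}"
proof
  fix p assume "p \<in> degree_a_queries H n S"
  then obtain \<tau>s where "p = (\<lambda>w. map (\<lambda>\<tau>. a_query n S \<tau> w) \<tau>s)" "length \<tau>s = H"
    "set \<tau>s \<subseteq> assignment_perms n S"
    by (auto simp: degree_a_queries_def)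
  then show "p \<in> {\<lambda>w. map (\<lambda>q. q w) qs | qs. length qs = H \<and> set qs \<subseteq> a_queries n S}"
    by (intro CollectI exI[of _ "map (a_query n S) \<tau>s"]) (auto simp: a_queries_def comp_def)
qed

theorem proposition5:
  fixes n H :: nat
    and S :: "nat \<Rightarrow> 'a set"
    and Y :: "'o set"
    and f :: "(nat \<Rightarrow> 'a) \<Rightarrow> 'o"
  assumes "n \<ge> 1"
    and "\<And>i. i \<in> {1..n} \<Longrightarrow> finite (S i) \<and> S i \<noteq> {}"
    and "finite Y" and "Y \<noteq> {}"
    and "f \<in> inputs n S \<rightarrow> Y"
    and "H \<ge> 1"
  shows "rk n S Y f \<le> H * rk_degree H n S Y f"
proof -
  let ?W = "inputs n S" and ?Q = "a_queries n S" and ?QH = "degree_a_queries H n S"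
  have W: "finite ?W" "?W \<noteq> {}"
    using assms(2) by (auto simp: inputs_def PiE_eq_empty_iff intro!: finite_PiE)
  have "finite (assignments n S)"
    using assms(2) by (auto simp: assignments_def)
  \<comment> \<open>Separation with \<open>V\<close> equal to all inputs yields some tree, so
    \<open>rk_degree\<close> is the depth of an actual tree.\<close>
  then have "\<exists>t. decision_tree ?W ?QH Y t \<and> computes ?W t f"
    using assms by (intro separating_queries_compute degree_a_queries_separate W(1)) auto
  then obtain t where t: "decision_tree ?W ?QH Y t" "computes ?W t f"
    "depth t = rk_degree H n S Y f"
    unfolding rk_degree_def by (metis min_depth_attained)
  obtain t' where t': "decision_tree ?W ?Q Y t'" "depth t' \<le> H * depth t"
    "\<forall>w\<in>?W. tree_output t' w = tree_output t w"
    using simulate_product_queries[OF W assms(4) degree_a_queries_subset t(1)] by blast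
  have "computes ?W t' f"
    using t(2) t'(3) by (simp add: computes_def)
  then have "rk n S Y f \<le> depth t'"
    unfolding rk_def using t'(1) by (intro min_depth_le)
  with t'(2) t(3) show ?thesis by simp
qed

end
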